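(* For all integers $n\geq 3$ and $m\geq 2$, $$sn(C_n\circ P_m)=n+1.$$
   Context: All graphs are finite, undirected, simple and connected. $\chi(G)$ is the chromatic number. $C_n$ is the cycle on $n$ vertices and $P_m$ is the path on $m$ vertices. Sudoku number: let $\chi(G)=k$ and fix the set of $k$ colors $\{1,\dots,k\}$. For $S\subset V(G)$ let $C_0$ be a proper coloring of the induced subgraph $G[S]$ with colors from these $k$ colors (at most $k$ colors are used). $C_0$ is called extendable if it can be extended to a proper coloring of $G$ with these $k$ colors, and it is a Sudoku coloring of $G$ if this extension exists and is unique. The Sudoku number $sn(G)$ is the smallest $|S|$ such that $G[S]$ admits a Sudoku coloring. Corona product: $G\circ H$ is obtained from one copy of $G$ and $|V(G)|$ disjoint copies of $H$ by joining the $i$-th vertex of $G$ to every vertex of the $i$-th copy of $H$. *)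

theory Defs
  imports "Graph_Theory.Graph_Theory" "HOL-Library.FuncSet"
begin

text \<open>
  Finite simple undirected graphs are represented as in the AFP entry \<open>Graph_Theory\<close>: an edge
  is a pair of opposite arcs, and the concrete graphs below satisfy \<^locale>\<open>pair_graph\<close>.
\<close>

section \<open>Cycles, paths and the corona product\<close>

text \<open>This is the cycle on \<open>n\<close> vertices only for \<open>n \<ge> 3\<close>.\<close>
definition cycle_graph :: "nat \<Rightarrow> nat pair_pre_digraph" where
  "cycle_graph n = \<lparr> pverts = {..<n},
     parcs = {(i, j). i < n \<and> j < n \<and> (j = (i + 1) mod n \<or> i = (j + 1) mod n)} \<rparr>"

definition path_graph :: "nat \<Rightarrow> nat pair_pre_digraph" where
  "path_graph m = \<lparr> pverts = {..<m},
     parcs = {(i, j). i < m \<and> j < m \<and> (j = i + 1 \<or> i = j + 1)} \<rparr>"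

text \<open>\<open>Inl v\<close> is the vertex \<open>v\<close> of \<open>G\<close>; \<open>Inr (v, x)\<close> is the vertex \<open>x\<close> of the copy of \<open>H\<close>
  attached to \<open>v\<close>.\<close>
definition corona ::
  "'a pair_pre_digraph \<Rightarrow> 'b pair_pre_digraph \<Rightarrow> ('a + 'a \<times> 'b) pair_pre_digraph" where
  "corona G H = \<lparr> pverts = pverts G <+> (pverts G \<times> pverts H),
     parcs = {(Inl u, Inl v) | u v. (u, v) \<in> parcs G}
           \<union> {(Inr (v, x), Inr (v, y)) | v x y. v \<in> pverts G \<and> (x, y) \<in> parcs H}
           \<union> {(Inl v, Inr (v, x)) | v x. v \<in> pverts G \<and> x \<in> pverts H}
           \<union> {(Inr (v, x), Inl v) | v x. v \<in> pverts G \<and> x \<in> pverts H} \<rparr>"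

lemma pair_graph_cycle_graph: "n \<ge> 3 \<Longrightarrow> pair_graph (cycle_graph n)"
proof -
  assume n: "n \<ge> 3"
  have "finite (parcs (cycle_graph n))"
    by (rule finite_subset[of _ "{..<n} \<times> {..<n}"]) (auto simp: cycle_graph_def)
  moreover have "Suc i mod n \<noteq> i" "i \<noteq> Suc i mod n" if "i < n" for i
    using n that by (cases "Suc i = n"; auto)+
  ultimately show ?thesis
    by unfold_locales (auto simp: cycle_graph_def symmetric_def intro!: symI)
qed

lemma pair_graph_path_graph: "pair_graph (path_graph m)"
proof -
  have "finite (parcs (path_graph m))"
    by (rule finite_subset[of _ "{..<m} \<times> {..<m}"]) (auto simp: path_graph_def)
  then show ?thesis
    by unfold_locales (auto simp: path_graph_def symmetric_def intro!: symI)
qed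

lemma pair_graph_corona:
  assumes "pair_graph G" "pair_graph H"
  shows "pair_graph (corona G H)"
proof -
  interpret G: pair_graph G by fact
  interpret H: pair_graph H by fact
  have "parcs (corona G H) \<subseteq> pverts (corona G H) \<times> pverts (corona G H)"
    by (auto simp: corona_def dest: G.wellformed' H.wellformed')
  moreover have fin: "finite (pverts (corona G H))"
    by (simp add: corona_def)
  ultimately have "finite (parcs (corona G H))"
    by (meson finite_SigmaI finite_subset)
  moreover have "sym (parcs G)" "sym (parcs H)"
    using G.pair_sym_arcs H.pair_sym_arcs by (simp_all add: symmetric_def)
  ultimately show ?thesis
    using fin
    by unfold_locales
      (auto simp: corona_def symmetric_def dest: G.wellformed' H.wellformed'
         G.pair_no_loops H.pair_no_loops symD intro!: symI)
qed

section \<open>Colorings and the Sudoku number\<close>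

text \<open>Colorings are extensional functions on the vertex set, so that distinct colorings differ
  on some vertex and uniqueness of an extension can be expressed by \<open>\<exists>!\<close>.\<close>
definition proper_coloring :: "('a, 'b) pre_digraph \<Rightarrow> nat \<Rightarrow> ('a \<Rightarrow> nat) \<Rightarrow> bool" where
  "proper_coloring G k c \<longleftrightarrow>
     c \<in> verts G \<rightarrow>\<^sub>E {1..k} \<and> (\<forall>e\<in>arcs G. c (tail G e) \<noteq> c (head G e))"

definition chromatic_number :: "('a, 'b) pre_digraph \<Rightarrow> nat" where
  "chromatic_number G = (LEAST k. \<exists>c. proper_coloring G k c)"

text \<open>\<open>c\<close> is an extension of the partial coloring \<open>c0\<close> of \<open>S\<close> to all of \<open>G\<close>.\<close>
definition extension ::
  "('a, 'b) pre_digraph \<Rightarrow> 'a set \<Rightarrow> ('a \<Rightarrow> nat) \<Rightarrow> ('a \<Rightarrow> nat) \<Rightarrow> bool" where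
  "extension G S c0 c \<longleftrightarrow>
     proper_coloring G (chromatic_number G) c \<and> (\<forall>v\<in>S. c v = c0 v)"

definition sudoku_coloring :: "('a, 'b) pre_digraph \<Rightarrow> 'a set \<Rightarrow> ('a \<Rightarrow> nat) \<Rightarrow> bool" where
  "sudoku_coloring G S c0 \<longleftrightarrow>
     proper_coloring (G \<restriction> S) (chromatic_number G) c0 \<and> (\<exists>!c. extension G S c0 c)"

definition sudoku_number :: "('a, 'b) pre_digraph \<Rightarrow> nat" where
  "sudoku_number G =
     (LEAST s. \<exists>S c0. S \<subseteq> verts G \<and> card S = s \<and> sudoku_coloring G S c0)"

text \<open>For finite loop-free graphs, both minima range over nonempty sets.\<close>

lemma (in digraph) chromatic_number_attained:
  "\<exists>c. proper_coloring G (chromatic_number G) c"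
proof -
  obtain f where f: "bij_betw f (verts G) {1..card (verts G)}"
    using ex_bij_betw_finite_nat finite_verts
    by (metis card_atLeastAtMost diff_Suc_1 finite_atLeastAtMost finite_same_card_bij)
  then have "f v \<in> {1..card (verts G)}" if "v \<in> verts G" for v
    using that by (auto simp: bij_betw_def)
  moreover have "f (tail G e) \<noteq> f (head G e)" if "e \<in> arcs G" for e
    using f that no_loops[OF that] by (auto simp: bij_betw_def dest: inj_onD)
  ultimately have "proper_coloring G (card (verts G)) (restrict f (verts G))"
    by (auto simp: proper_coloring_def)
  then have "\<exists>k c. proper_coloring G k c" by blast
  then show ?thesis
    unfolding chromatic_number_def by (rule LeastI_ex)
qed

lemma (in digraph) sudoku_number_attained:
  "\<exists>S c0. S \<subseteq> verts G \<and> card S = sudoku_number G \<and> sudoku_coloring G S c0"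
proof -
  obtain c where c: "proper_coloring G (chromatic_number G) c"
    using chromatic_number_attained by blast
  have "proper_coloring (G \<restriction> verts G) (chromatic_number G) c"
    using c by (auto simp: proper_coloring_def)
  moreover have "\<exists>!d. extension G (verts G) c d"
  proof (rule ex1I[of _ c])
    show "extension G (verts G) c c" using c by (simp add: extension_def)
    show "d = c" if "extension G (verts G) c d" for d
      using c that unfolding extension_def proper_coloring_def by (metis PiE_ext)
  qed
  ultimately have "sudoku_coloring G (verts G) c"
    by (simp add: sudoku_coloring_def)
  then have "\<exists>s S c0. S \<subseteq> verts G \<and> card S = s \<and> sudoku_coloring G S c0" by blast
  then show ?thesis unfolding sudoku_number_def by (rule LeastI_ex)
qed

end

theory Submission
  imports Defs
begin

text \<open>
  In a proper 3-coloring of \<open>G \<circ> P\<^sub>m\<close> the copy of \<open>P\<^sub>m\<close> at \<open>v\<close> alternates between the two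
  colors different from that of \<open>v\<close>, so it is determined by the color of \<open>v\<close> and that of one
  of its own vertices. Interchanging the two colors in one copy shows that a Sudoku coloring must
  prescribe a vertex in every copy. If it prescribes nothing else, it amounts to a list
  coloring of the cycle from lists of size 2, and a cycle is never uniquely colorable from such
  lists. One additional vertex suffices: after fixing the color of the cycle vertex \<open>0\<close>, let the
  copy at \<open>i\<close> forbid at \<open>i\<close> the color used neither at \<open>i\<close> nor at \<open>i - 1\<close>; the colors along the
  cycle are then forced one after the other.
\<close>

section \<open>Colorings of cycles from lists of size two\<close>

text \<open>Colorings of a cycle are handled as \<open>n\<close>-periodic functions on the naturals,
  so that rotating the cycle becomes a shift of the index.\<close>

lemma periodic_mod:
  fixes f :: "nat \<Rightarrow> 'a"
  assumes "\<And>i. f (i + n) = f i"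
  shows "f (i mod n) = f i"
proof -
  have "f (j + k * n) = f j" for j k
  proof (induction k)
    case (Suc k)
    then show ?case using assms[of "j + k * n"] by (simp add: add_ac)
  qed simp
  from this[of "i mod n" "i div n"] show ?thesis by simp
qed

lemma periodic_neq_SucI:
  fixes h :: "nat \<Rightarrow> 'a"
  assumes per: "\<And>i. h (i + n) = h i" and n: "n > 0"
    and inner: "\<And>i. Suc i < n \<Longrightarrow> h i \<noteq> h (Suc i)" and wrap: "h (n - 1) \<noteq> h 0"
  shows "h i \<noteq> h (Suc i)"
proof (cases "Suc (i mod n) < n")
  case True
  then have "h (Suc i) = h (Suc (i mod n))"
    using periodic_mod[of h n "Suc i", OF per] by (simp add: mod_Suc split: if_splits)
  then show ?thesis using inner[OF True] periodic_mod[of h n i, OF per] by simp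
next
  case False
  then have *: "i mod n = n - 1" using n mod_less_divisor[of n i] by linarith
  then have "Suc i mod n = 0" using n by (simp add: mod_Suc)
  then show ?thesis
    using wrap periodic_mod[of h n i, OF per] periodic_mod[of h n "Suc i", OF per] * by simp
qed

text \<open>If \<open>f\<close> were the only choice, then switching any initial or final segment of
  the cycle from \<open>f\<close> to \<open>g\<close> would have to create a conflict. As
  \<open>eq\<close> makes the closing edge harmless, the conflict sits at the inner end of the
  segment. This forces \<open>f\<close> to alternate, which contradicts either parity of
  \<open>n\<close>.\<close>

lemma cycle_second_choice_aux:
  fixes f g :: "nat \<Rightarrow> 'a"
  assumes n: "n \<ge> 3"
    and perf: "\<And>i. f (i + n) = f i" and perg: "\<And>i. g (i + n) = g i"
    and f: "\<And>i. f i \<noteq> f (Suc i)" and g: "\<And>i. g i \<noteq> f i" and eq: "g (n - 1) = g 0"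
  shows "\<exists>h. (\<forall>i. h (i + n) = h i) \<and> (\<forall>i. h i \<in> {f i, g i}) \<and> (\<forall>i. h i \<noteq> h (Suc i)) \<and> h \<noteq> f"
proof (rule ccontr)
  assume neg: "\<not> ?thesis"
  \<comment> \<open>\<open>P\<close> marks the vertices of the cycle that take their second color;
    it is read only at \<open>i mod n\<close>, so its values from \<open>n\<close> on are
    irrelevant.\<close>
  have no_switch: False
    if "\<And>i. Suc i < n \<Longrightarrow> (if P i then g i else f i) \<noteq> (if P (Suc i) then g (Suc i) else f (Suc i))"
      "(if P (n - 1) then g (n - 1) else f (n - 1)) \<noteq> (if P 0 then g 0 else f 0)"
      "j < n" "P j" for P :: "nat \<Rightarrow> bool" and j
  proof -
    define h where "h i = (if P (i mod n) then g i else f i)" for i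
    have per: "h (i + n) = h i" for i by (simp add: h_def perf perg)
    have "h i \<noteq> h (Suc i)" for i
      by (rule periodic_neq_SucI[of h n, OF per])
        (use n that(1,2) in \<open>simp_all add: h_def del: One_nat_def\<close>)
    moreover have "h \<noteq> f"
    proof
      assume "h = f"
      then have "h j = f j" by simp
      then show False using that g[of j] by (simp add: h_def)
    qed
    moreover have "h i \<in> {f i, g i}" for i by (simp add: h_def)
    ultimately show False using neg per by blast
  qed
  have f_last: "f (n - 1) \<noteq> f 0"
    using f[of "n - 1"] perf[of 0] n by simp
  \<comment> \<open>Switch the segment from 0 to \<open>j\<close>. By induction its inner edges are
    fine, and the closing edge is fine because \<open>g 0 = g (n - 1)\<close> differs from
    \<open>f (n - 1)\<close>; only the edge from \<open>j\<close> to \<open>Suc j\<close> can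
    fail.\<close>
  have right: "g j = f (Suc j)" if "Suc j < n" for j
    using that
  proof (induction j rule: less_induct)
    case (less j)
    show ?case
    proof (rule ccontr)
      assume "g j \<noteq> f (Suc j)"
      moreover have "g i \<noteq> g (Suc i)" if "i < j" for i
        using less that g[of "Suc i"] by simp
      ultimately show False
        using f less.prems eq g[of "n - 1"]
        by (intro no_switch[of "\<lambda>i. i \<le> j" j]) (auto simp: not_less_eq_eq le_less_Suc_eq)
    qed
  qed
  \<comment> \<open>The mirror image: switch the segment from \<open>n - Suc j\<close> to
    \<open>n - 1\<close>, with the induction running down from the last vertex.\<close>
  have left: "g (n - Suc j) = f (n - Suc (Suc j))" if "Suc j < n" for j
    using that
  proof (induction j rule: less_induct)
    case (less j)
    show ?case
    proof (rule ccontr)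
      assume *: "g (n - Suc j) \<noteq> f (n - Suc (Suc j))"
      define k where "k = n - Suc j"
      have k: "Suc (k - 1) = k" "k < n" "0 < k" using less.prems by (auto simp: k_def)
      have "g i \<noteq> g (Suc i)" if "k \<le> i" "Suc i < n" for i
      proof -
        have "n - Suc (n - Suc (Suc i)) = Suc i" "n - Suc (Suc (n - Suc (Suc i))) = i"
          using that by auto
        moreover have "n - Suc (Suc i) < j" using that less.prems by (auto simp: k_def)
        ultimately show ?thesis using less.IH[of "n - Suc (Suc i)"] that g[of i] less.prems by auto
      qed
      moreover have "f i \<noteq> g (Suc i)" if "Suc i = k" for i
        using that * less.prems by (auto simp: k_def) (metis Suc_diff_Suc diff_Suc_1 Suc_lessD that k_def)
      ultimately show False
        using f k eq g[of 0] n
        by (intro no_switch[of "\<lambda>i. k \<le> i" k]) (auto simp: le_Suc_eq)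
    qed
  qed
  \<comment> \<open>Both sides equal \<open>g (Suc i)\<close>, by \<open>right\<close> and
    \<open>left\<close> respectively.\<close>
  have step: "f (Suc (Suc i)) = f i" if "Suc (Suc i) < n" for i
    using right[of "Suc i"] left[of "n - Suc (Suc i)"] that
    by (simp add: Suc_diff_Suc)
  have alt: "f i = f (i mod 2)" if "i < n" for i
    using that
  proof (induction i rule: less_induct)
    case (less i)
    show ?case
    proof (cases "i < 2")
      case False
      then obtain k where "i = Suc (Suc k)" by (metis Suc_1 add_2_eq_Suc le_add_diff_inverse not_less)
      then show ?thesis using less.IH[of k] less.prems step[of k] by simp
    qed simp
  qed
  \<comment> \<open>For even \<open>n\<close>, \<open>g 0 = g (n - 1) = f (n - 2) = f 0\<close>; for
    odd \<open>n\<close>, the closing edge joins two equal colors of \<open>f\<close>.\<close>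
  show False
  proof (cases "even n")
    case True
    then have "f (n - 2) = f 0" using alt[of "n - 2"] n by simp
    moreover have "f (n - 2) = g 0" using left[of 0] eq n by (simp add: numeral_2_eq_2)
    ultimately show False using g[of 0] by simp
  next
    case False
    then have "f (n - 1) = f 0" using alt[of "n - 1"] n by simp
    then show False using f_last by simp
  qed
qed

text \<open>Either \<open>g\<close> itself is proper, or it has an edge with equal ends; rotating
  that edge to the closing position gives the situation of
  \<open>cycle_second_choice_aux\<close>.\<close>

lemma cycle_second_choice:
  fixes f g :: "nat \<Rightarrow> 'a"
  assumes n: "n \<ge> 3"
    and perf: "\<And>i. f (i + n) = f i" and perg: "\<And>i. g (i + n) = g i"
    and f: "\<And>i. f i \<noteq> f (Suc i)" and g: "\<And>i. g i \<noteq> f i"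
  shows "\<exists>h. (\<forall>i. h (i + n) = h i) \<and> (\<forall>i. h i \<in> {f i, g i}) \<and> (\<forall>i. h i \<noteq> h (Suc i)) \<and> h \<noteq> f"
proof (cases "\<exists>s. g s = g (Suc s)")
  case False
  moreover have "g \<noteq> f" using g by metis
  ultimately show ?thesis using perg by (intro exI[of _ g]) auto
next
  case True
  then obtain s where s: "g s = g (Suc s)" by blast
  have "\<exists>h. (\<forall>i. h (i + n) = h i) \<and> (\<forall>i. h i \<in> {f (i + Suc s), g (i + Suc s)})
      \<and> (\<forall>i. h i \<noteq> h (Suc i)) \<and> h \<noteq> (\<lambda>i. f (i + Suc s))"
  proof (rule cycle_second_choice_aux[OF n])
    show "f (i + n + Suc s) = f (i + Suc s)" "g (i + n + Suc s) = g (i + Suc s)" for i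
      using perf[of "i + Suc s"] perg[of "i + Suc s"] by (simp_all add: add_ac)
    show "g (n - 1 + Suc s) = g (0 + Suc s)"
      using perg[of s] s n by (simp add: add_ac)
    show "f (i + Suc s) \<noteq> f (Suc i + Suc s)" for i using f[of "i + Suc s"] by simp
    show "g (i + Suc s) \<noteq> f (i + Suc s)" for i by (rule g)
  qed
  then obtain h where h: "\<And>i. h (i + n) = h i" "\<And>i. h i \<in> {f (i + Suc s), g (i + Suc s)}"
      "\<And>i. h i \<noteq> h (Suc i)" and hf: "h \<noteq> (\<lambda>i. f (i + Suc s))"
    by blast
  \<comment> \<open>The rotation by \<open>Suc s\<close> is undone by a further shift forward:
    \<open>t + Suc s\<close> is a multiple of \<open>n\<close>, which avoids subtraction on the
    naturals.\<close>
  define t where "t = Suc s * (n - 1)"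
  have t: "t + Suc s = Suc s * n" using n by (cases n) (simp_all add: t_def)
  have shift_back: "F (i + t + Suc s) = F i" if "\<And>i. F (i + n) = F i" for F :: "nat \<Rightarrow> 'a" and i
  proof -
    have "(i + t + Suc s) mod n = i mod n" unfolding add.assoc t by (rule mod_mult_self1)
    then show ?thesis using periodic_mod[of F n, OF that] by metis
  qed
  have "(\<lambda>i. h (i + t)) \<noteq> f"
  proof
    assume "(\<lambda>i. h (i + t)) = f"
    then have "h (i + Suc s + t) = f (i + Suc s)" for i by metis
    then have "h i = f (i + Suc s)" for i using shift_back[of h i, OF h(1)] by (simp add: add_ac)
    then show False using hf by auto
  qed
  moreover have "h (i + t) \<in> {f i, g i}" for i
    using h(2)[of "i + t"] shift_back[of f i, OF perf] shift_back[of g i, OF perg] by simp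
  moreover have "h (i + n + t) = h (i + t)" "h (i + t) \<noteq> h (Suc i + t)" for i
    using h(1)[of "i + t"] h(3)[of "i + t"] by (simp_all add: add_ac)
  ultimately show ?thesis by (intro exI[of _ "\<lambda>i. h (i + t)"]) blast
qed

section \<open>Three-colorings of coronas with paths\<close>

text \<open>The three colors sum to 6, which gives the remaining color a closed form.\<close>

lemma third_color:
  fixes a b :: nat
  assumes "a \<in> {1..3}" "b \<in> {1..3}" "a \<noteq> b"
  shows "6 - a - b \<in> {1..3}" "6 - a - b \<noteq> a" "6 - a - b \<noteq> b"
    "c \<in> {1..3} \<Longrightarrow> c \<noteq> a \<Longrightarrow> c \<noteq> b \<Longrightarrow> c = 6 - a - b"
proof -
  have "a \<in> {1, 2, 3}" "b \<in> {1, 2, 3}" using assms by auto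
  then show "6 - a - b \<in> {1..3}" "6 - a - b \<noteq> a" "6 - a - b \<noteq> b"
    "c \<in> {1..3} \<Longrightarrow> c \<noteq> a \<Longrightarrow> c \<noteq> b \<Longrightarrow> c = 6 - a - b"
    using assms(3) by auto
qed

lemma proper_coloring_corona_path:
  "proper_coloring (with_proj (corona G (path_graph m))) k c \<longleftrightarrow>
     c \<in> pverts G <+> (pverts G \<times> {..<m}) \<rightarrow>\<^sub>E {1..k} \<and>
     (\<forall>(u, v) \<in> parcs G. c (Inl u) \<noteq> c (Inl v)) \<and>
     (\<forall>v\<in>pverts G. (\<forall>x<m. c (Inr (v, x)) \<noteq> c (Inl v)) \<and>
        (\<forall>x. Suc x < m \<longrightarrow> c (Inr (v, x)) \<noteq> c (Inr (v, Suc x))))"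
  (is "?L \<longleftrightarrow> ?R")
proof
  assume L: ?L
  then have *: "c (fst e) \<noteq> c (snd e)" if "e \<in> parcs (corona G (path_graph m))" for e
    using that by (auto simp: proper_coloring_def)
  have "c (Inl u) \<noteq> c (Inl v)" if "(u, v) \<in> parcs G" for u v
    using *[of "(Inl u, Inl v)"] that by (auto simp: corona_def)
  moreover have "c (Inr (v, x)) \<noteq> c (Inl v)" if "v \<in> pverts G" "x < m" for v x
    using *[of "(Inr (v, x), Inl v)"] that by (auto simp: corona_def path_graph_def)
  moreover have "c (Inr (v, x)) \<noteq> c (Inr (v, Suc x))" if "v \<in> pverts G" "Suc x < m" for v x
    using *[of "(Inr (v, x), Inr (v, Suc x))"] that by (auto simp: corona_def path_graph_def)
  ultimately show ?R
    using L by (auto simp: proper_coloring_def corona_def path_graph_def)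
next
  assume R: ?R
  have "c (fst e) \<noteq> c (snd e)" if "e \<in> parcs (corona G (path_graph m))" for e
    using that R by (fastforce simp: corona_def path_graph_def)
  with R show ?L
    by (auto simp: proper_coloring_def corona_def path_graph_def)
qed

text \<open>The proper 3-coloring with color \<open>h v\<close> at \<open>v\<close> and color \<open>q v\<close> at the vertex \<open>x v\<close> of the
  copy attached to \<open>v\<close>; \<open>6 - h v - q v\<close> is the third color.\<close>
definition corona_path_coloring ::
  "'a pair_pre_digraph \<Rightarrow> nat \<Rightarrow> ('a \<Rightarrow> nat) \<Rightarrow> ('a \<Rightarrow> nat) \<Rightarrow> ('a \<Rightarrow> nat) \<Rightarrow> 'a + 'a \<times> nat \<Rightarrow> nat" where
  "corona_path_coloring G m h q x =
     restrict (case_sum h (\<lambda>(v, y). if even (y + x v) then q v else 6 - h v - q v))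
       (pverts G <+> (pverts G \<times> {..<m}))"

lemma corona_path_coloring_simps [simp]:
  assumes "v \<in> pverts G"
  shows "corona_path_coloring G m h q x (Inl v) = h v"
    and "y < m \<Longrightarrow> corona_path_coloring G m h q x (Inr (v, y)) =
           (if even (y + x v) then q v else 6 - h v - q v)"
  using assms by (auto simp: corona_path_coloring_def)

lemma proper_corona_path_coloring:
  assumes h: "\<And>v. v \<in> pverts G \<Longrightarrow> h v \<in> {1..3}"
    and q: "\<And>v. v \<in> pverts G \<Longrightarrow> q v \<in> {1..3}" "\<And>v. v \<in> pverts G \<Longrightarrow> q v \<noteq> h v"
    and arcs: "\<And>u v. (u, v) \<in> parcs G \<Longrightarrow> u \<in> pverts G \<and> v \<in> pverts G \<and> h u \<noteq> h v"
  shows "proper_coloring (with_proj (corona G (path_graph m))) 3 (corona_path_coloring G m h q x)"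
proof -
  have third: "6 - h v - q v \<in> {1..3}" "6 - h v - q v \<noteq> h v" "6 - h v - q v \<noteq> q v"
    if "v \<in> pverts G" for v
    using third_color(1-3)[of "h v" "q v"] h q that by metis+
  have "corona_path_coloring G m h q x \<in> pverts G <+> (pverts G \<times> {..<m}) \<rightarrow>\<^sub>E {1..3}"
    unfolding corona_path_coloring_def restrict_PiE_iff using h q third by auto
  moreover have "q v \<noteq> 6 - h v - q v" "6 - h v - q v \<noteq> q v" if "v \<in> pverts G" for v
    using third(3)[OF that] by auto
  ultimately show ?thesis
    unfolding proper_coloring_corona_path using q third arcs by auto
qed

text \<open>Each step along the path takes the third color besides those of \<open>v\<close> and of
  the previous vertex, and two steps restore the color; so only parity matters, and any position
  \<open>x\<close> can serve as reference.\<close>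

lemma coloring_corona_path_copy:
  assumes c: "proper_coloring (with_proj (corona G (path_graph m))) 3 c"
    and v: "v \<in> pverts G" and x: "x < m" and y: "y < m"
  shows "c (Inr (v, y)) = (if even (y + x) then c (Inr (v, x)) else 6 - c (Inl v) - c (Inr (v, x)))"
proof -
  have rng: "c (Inl v) \<in> {1..3}" "\<And>z. z < m \<Longrightarrow> c (Inr (v, z)) \<in> {1..3}"
    and ne: "\<And>z. z < m \<Longrightarrow> c (Inr (v, z)) \<noteq> c (Inl v)"
      "\<And>z. Suc z < m \<Longrightarrow> c (Inr (v, z)) \<noteq> c (Inr (v, Suc z))"
    using c v unfolding proper_coloring_corona_path by auto
  have step: "c (Inr (v, Suc z)) = 6 - c (Inl v) - c (Inr (v, z))" if "Suc z < m" for z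
    using third_color(4)[of "c (Inl v)" "c (Inr (v, z))" "c (Inr (v, Suc z))"] rng ne that
    by (metis Suc_lessD)
  have from0: "c (Inr (v, z)) = (if even z then c (Inr (v, 0)) else 6 - c (Inl v) - c (Inr (v, 0)))"
    if "z < m" for z
    using that
  proof (induction z)
    case (Suc z)
    then show ?case using step[of z] rng(1) rng(2)[of 0] ne(1)[of 0] by auto
  qed simp
  show ?thesis
    using from0[OF x] from0[OF y] rng(1) rng(2)[of 0] ne(1)[of 0] x by auto
qed

lemma chromatic_number_corona_path:
  assumes c: "proper_coloring (with_proj (corona G (path_graph m))) 3 c"
    and v: "v \<in> pverts G" and m: "m \<ge> 2"
  shows "chromatic_number (with_proj (corona G (path_graph m))) = 3"
  unfolding chromatic_number_def
proof (rule Least_equality)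
  show "\<exists>c. proper_coloring (with_proj (corona G (path_graph m))) 3 c" using c by blast
next
  fix k assume "\<exists>c. proper_coloring (with_proj (corona G (path_graph m))) k c"
  then obtain d where d: "proper_coloring (with_proj (corona G (path_graph m))) k d" by blast
  \<comment> \<open>The vertex \<open>v\<close> and the first two vertices of its copy form a
    triangle; the second one exists because \<open>m\<close> is at least 2.\<close>
  have "d (Inl v) \<in> {1..k}" "d (Inr (v, 0)) \<in> {1..k}" "d (Inr (v, 1)) \<in> {1..k}"
    "d (Inr (v, 0)) \<noteq> d (Inl v)" "d (Inr (v, 1)) \<noteq> d (Inl v)" "d (Inr (v, 0)) \<noteq> d (Inr (v, 1))"
    using d v m unfolding proper_coloring_corona_path by auto
  then show "3 \<le> k" by auto
qed

lemma sudoku_coloring_meets_copy: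
  assumes S: "sudoku_coloring (with_proj (corona G (path_graph m))) S c0"
    and chi: "chromatic_number (with_proj (corona G (path_graph m))) = 3"
    and G: "pair_wf_digraph G" and v: "v \<in> pverts G" and m: "m > 0"
  shows "\<exists>x<m. Inr (v, x) \<in> S"
proof (rule ccontr)
  assume no: "\<not> ?thesis"
  let ?K = "with_proj (corona G (path_graph m))"
  obtain c where c: "extension ?K S c0 c" and uniq: "\<And>d. extension ?K S c0 d \<Longrightarrow> d = c"
    using S unfolding sudoku_coloring_def by blast
  from c have pc: "proper_coloring ?K 3 c" and cS: "\<And>w. w \<in> S \<Longrightarrow> c w = c0 w"
    by (auto simp: extension_def chi)
  have col: "c (Inl u) \<in> {1..3}" "c (Inr (u, 0)) \<in> {1..3}" "c (Inr (u, 0)) \<noteq> c (Inl u)"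
    if "u \<in> pverts G" for u
    using pc that m unfolding proper_coloring_corona_path by auto
  have arcs: "u \<in> pverts G \<and> w \<in> pverts G \<and> c (Inl u) \<noteq> c (Inl w)" if "(u, w) \<in> parcs G" for u w
    using pc that pair_wf_digraph.in_arcsD1[OF G that] pair_wf_digraph.in_arcsD2[OF G that]
    unfolding proper_coloring_corona_path by auto
  \<comment> \<open>Rebuilding the coloring from the colors at position 0 reproduces
    \<open>c\<close>, except that the update at \<open>v\<close> interchanges the two colors of its
    copy.\<close>
  define q where "q = (\<lambda>u. c (Inr (u, 0)))(v := 6 - c (Inl v) - c (Inr (v, 0)))"
  define d where "d = corona_path_coloring G m (\<lambda>u. c (Inl u)) q (\<lambda>_. 0)"
  have third: "q v \<in> {1..3}" "q v \<noteq> c (Inl v)" "q v \<noteq> c (Inr (v, 0))"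
    using third_color(1-3)[of "c (Inl v)" "c (Inr (v, 0))"] col[OF v] by (auto simp: q_def)
  have pd: "proper_coloring ?K 3 d"
    unfolding d_def
    by (rule proper_corona_path_coloring) (use col arcs third in \<open>auto simp: q_def\<close>)
  have "d w = c w" if "w \<in> S" for w
  proof (cases "w \<in> pverts G <+> (pverts G \<times> {..<m})")
    case True
    then show ?thesis
    proof (elim PlusE)
      fix u assume "w = Inl u" "u \<in> pverts G"
      then show ?thesis by (simp add: d_def)
    next
      fix p assume p: "w = Inr p" "p \<in> pverts G \<times> {..<m}"
      then obtain u x where ux: "p = (u, x)" "u \<in> pverts G" "x < m" by auto
      then have "u \<noteq> v" using no that p by auto
      then show ?thesis
        using coloring_corona_path_copy[OF pc ux(2) m ux(3)] ux p by (simp add: d_def q_def)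
    qed
  next
    \<comment> \<open>\<open>S\<close> is not assumed to consist of vertices; off the vertex set
      both colorings are \<open>undefined\<close>.\<close>
    case False
    then show ?thesis
      using pc pd unfolding proper_coloring_corona_path by (auto simp: PiE_def extensional_def)
  qed
  then have "extension ?K S c0 d" using pd cS by (simp add: extension_def chi)
  then have "d (Inr (v, 0)) = c (Inr (v, 0))" using uniq by simp
  then show False using third v m by (simp add: d_def)
qed

section \<open>The corona of a cycle and a path\<close>

lemma cycle_graph_simps [simp]:
  "pverts (cycle_graph n) = {..<n}"
  by (simp add: cycle_graph_def)

lemma cycle_graph_arcs_neqI:
  assumes n: "n \<ge> 3" and arc: "(i, j) \<in> parcs (cycle_graph n)"
    and inner: "\<And>i. Suc i < n \<Longrightarrow> h i \<noteq> h (Suc i)" and wrap: "h (n - 1) \<noteq> h 0"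
  shows "i \<in> pverts (cycle_graph n) \<and> j \<in> pverts (cycle_graph n) \<and> h i \<noteq> h j"
proof -
  have *: "h i \<noteq> h (Suc i mod n)" if "i < n" for i
    using inner[of i] wrap that by (cases "Suc i = n") auto
  then show ?thesis
    using arc *[of i] not_sym[OF *[of j]] by (auto simp: cycle_graph_def)
qed

text \<open>Giving the last vertex color 3 in every case avoids a distinction by the parity of
  \<open>n\<close>.\<close>

definition cycle_coloring :: "nat \<Rightarrow> nat \<Rightarrow> nat" where
  "cycle_coloring n i = (if i = n - 1 then 3 else i mod 2 + 1)"

lemma cycle_coloring:
  assumes "n \<ge> 3"
  shows "cycle_coloring n i \<in> {1..3}" "Suc i < n \<Longrightarrow> cycle_coloring n i \<noteq> cycle_coloring n (Suc i)"
    "cycle_coloring n 0 = 1" "cycle_coloring n (n - 1) = 3"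
proof -
  have "i mod 2 < 2" by simp
  then show "cycle_coloring n i \<in> {1..3}" by (auto simp: cycle_coloring_def simp del: mod_less_divisor)
  show "Suc i < n \<Longrightarrow> cycle_coloring n i \<noteq> cycle_coloring n (Suc i)"
    by (auto simp: cycle_coloring_def mod_Suc)
qed (use assms in \<open>auto simp: cycle_coloring_def\<close>)

text \<open>The color forbidden at \<open>i\<close> by its copy, with \<open>3\<close> the color of the predecessor \<open>n - 1\<close> of \<open>0\<close>.\<close>
definition cycle_forbidden :: "nat \<Rightarrow> nat \<Rightarrow> nat" where
  "cycle_forbidden n i =
     6 - cycle_coloring n i - (if i = 0 then 3 else cycle_coloring n (i - 1))"

lemma cycle_forbidden:
  assumes "n \<ge> 3" "i < n"
  shows "cycle_forbidden n i \<in> {1..3}" "cycle_forbidden n i \<noteq> cycle_coloring n i"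
proof -
  define p where "p = (if i = 0 then 3 else cycle_coloring n (i - 1))"
  have "p \<in> {1..3}" using cycle_coloring(1)[OF assms(1)] by (simp add: p_def)
  moreover have "p \<noteq> cycle_coloring n i"
    using cycle_coloring(2)[OF assms(1), of "i - 1"] cycle_coloring(3)[OF assms(1)] assms(2)
    by (cases i) (auto simp: p_def)
  ultimately show "cycle_forbidden n i \<in> {1..3}" "cycle_forbidden n i \<noteq> cycle_coloring n i"
    using third_color(1-3)[of "cycle_coloring n i" p] cycle_coloring(1)[OF assms(1), of i]
    by (auto simp: cycle_forbidden_def p_def)
qed

text \<open>This coloring serves twice: it bounds the chromatic number by 3, and it is the solution
  of the Sudoku constructed below.\<close>

lemma proper_corona_cycle_path:
  assumes n: "n \<ge> 3"
  shows "proper_coloring (with_proj (corona (cycle_graph n) (path_graph m))) 3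
    (corona_path_coloring (cycle_graph n) m (cycle_coloring n) (cycle_forbidden n) (\<lambda>_. 0))"
proof (rule proper_corona_path_coloring)
  show "i \<in> pverts (cycle_graph n) \<and> j \<in> pverts (cycle_graph n) \<and>
      cycle_coloring n i \<noteq> cycle_coloring n j" if "(i, j) \<in> parcs (cycle_graph n)" for i j
    using cycle_coloring[OF n] by (intro cycle_graph_arcs_neqI[OF n that]) auto
qed (use cycle_coloring[OF n] cycle_forbidden[OF n] in auto)

section \<open>Chromatic number 3 and the upper bound\<close>

lemma chromatic_number_corona_cycle_path:
  assumes "n \<ge> 3" "m \<ge> 2"
  shows "chromatic_number (with_proj (corona (cycle_graph n) (path_graph m))) = 3"
  using chromatic_number_corona_path[OF proper_corona_cycle_path[OF assms(1)], of 0 m] assms by simp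

lemma sudoku_coloring_corona_cycle_path:
  assumes n: "n \<ge> 3" and m: "m \<ge> 2"
  defines "S \<equiv> insert (Inl 0) ((\<lambda>i. Inr (i, 0)) ` {..<n})"
  shows "\<exists>c0. sudoku_coloring (with_proj (corona (cycle_graph n) (path_graph m))) S c0"
proof -
  let ?K = "with_proj (corona (cycle_graph n) (path_graph m))"
  define c where "c = corona_path_coloring (cycle_graph n) m
    (cycle_coloring n) (cycle_forbidden n) (\<lambda>_. 0)"
  have chi: "chromatic_number ?K = 3" by (rule chromatic_number_corona_cycle_path[OF n m])
  have pc: "proper_coloring ?K 3 c"
    unfolding c_def by (rule proper_corona_cycle_path[OF n])
  have SV: "S \<subseteq> verts ?K"
    using n m by (auto simp: S_def corona_def path_graph_def)
  \<comment> \<open>The prescribed coloring must be extensional on the induced subgraph, hence the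
    restriction to \<open>S\<close>.\<close>
  have "proper_coloring (?K \<restriction> S) 3 (restrict c S)"
    using pc SV by (auto simp: proper_coloring_def induce_subgraph_def)
  moreover have "\<exists>!d. extension ?K S (restrict c S) d"
  proof (rule ex1I)
    show "extension ?K S (restrict c S) c" using pc by (simp add: extension_def chi)
  next
    fix d assume "extension ?K S (restrict c S) d"
    then have pd: "proper_coloring ?K 3 d" and dS: "\<And>w. w \<in> S \<Longrightarrow> d w = c w"
      by (auto simp: extension_def chi)
    have d0: "d (Inl 0) = cycle_coloring n 0"
      using dS[of "Inl 0"] n by (simp add: S_def c_def)
    have dq: "d (Inr (i, 0)) = cycle_forbidden n i" if "i < n" for i
      using dS[of "Inr (i, 0)"] n m that by (simp add: S_def c_def)
    \<comment> \<open>At \<open>Suc i\<close> the neighbor \<open>i\<close> and the prescribed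
      vertex of the copy exclude exactly the two colors other than
      \<open>cycle_coloring n (Suc i)\<close>.\<close>
    have dh: "d (Inl i) = cycle_coloring n i" if "i < n" for i
      using that
    proof (induction i)
      case (Suc i)
      have "(i, Suc i) \<in> parcs (cycle_graph n)" using Suc.prems by (simp add: cycle_graph_def)
      then have "d (Inl i) \<noteq> d (Inl (Suc i))" "d (Inr (Suc i, 0)) \<noteq> d (Inl (Suc i))"
        "d (Inl (Suc i)) \<in> {1..3}"
        using pd m Suc.prems unfolding proper_coloring_corona_path by auto
      then show ?case
        using Suc dq[OF Suc.prems] cycle_coloring(1)[OF n, of i] cycle_coloring(1)[OF n, of "Suc i"]
          cycle_coloring(2)[OF n, of i]
        by (auto simp: cycle_forbidden_def)
    qed (rule d0)
    have "d w = c w" if "w \<in> {..<n} <+> ({..<n} \<times> {..<m})" for w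
      using that
    proof (elim PlusE)
      fix i assume "w = Inl i" "i \<in> {..<n}"
      then show ?thesis using dh by (simp add: c_def)
    next
      fix p assume p: "w = Inr p" "p \<in> {..<n} \<times> {..<m}"
      then obtain i x where ix: "p = (i, x)" "i < n" "x < m" by auto
      then show ?thesis
        using coloring_corona_path_copy[OF pd, of i 0 x] p dh dq by (simp add: c_def)
    qed
    then show "d = c"
      using pc pd unfolding proper_coloring_corona_path by (auto intro: PiE_ext)
  qed
  ultimately show ?thesis unfolding sudoku_coloring_def chi by blast
qed

section \<open>The lower bound\<close>

lemma sudoku_coloring_card_gt:
  assumes n: "n \<ge> 3" and m: "m \<ge> 2"
    and S: "sudoku_coloring (with_proj (corona (cycle_graph n) (path_graph m))) S c0"
    and fin: "finite S"
  shows "card S > n"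
proof (rule ccontr)
  assume "\<not> card S > n"
  then have card: "card S \<le> n" by simp
  let ?K = "with_proj (corona (cycle_graph n) (path_graph m))"
  have chi: "chromatic_number ?K = 3" by (rule chromatic_number_corona_cycle_path[OF n m])
  interpret C: pair_graph "cycle_graph n" by (rule pair_graph_cycle_graph[OF n])
  have "\<forall>i\<in>{..<n}. \<exists>x. x < m \<and> Inr (i, x) \<in> S"
    using sudoku_coloring_meets_copy[OF S chi C.pair_wf_digraph_axioms] m by auto
  then obtain x where x: "\<And>i. i < n \<Longrightarrow> x i < m" "\<And>i. i < n \<Longrightarrow> Inr (i, x i) \<in> S"
    using bchoice[of "{..<n}" "\<lambda>i x. x < m \<and> Inr (i, x) \<in> S"] by auto
  have "card ((\<lambda>i. Inr (i, x i) :: nat + nat \<times> nat) ` {..<n}) = n"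
    by (subst card_image) (auto intro: inj_onI)
  \<comment> \<open>One prescribed vertex from each copy already exhausts the bound
    \<open>n\<close>, so no vertex of the cycle is prescribed.\<close>
  then have S_eq: "S = (\<lambda>i. Inr (i, x i)) ` {..<n}"
    using card_seteq[OF fin, of "(\<lambda>i. Inr (i, x i)) ` {..<n}"] x card by auto
  obtain c where c: "extension ?K S c0 c" and uniq: "\<And>d. extension ?K S c0 d \<Longrightarrow> d = c"
    using S unfolding sudoku_coloring_def by blast
  from c have pc: "proper_coloring ?K 3 c" and cS: "\<And>w. w \<in> S \<Longrightarrow> c w = c0 w"
    by (auto simp: extension_def chi)
  define f where "f i = c (Inl (i mod n))" for i
  define q where "q i = c (Inr (i, x i))" for i
  \<comment> \<open>The prescribed color \<open>q\<close> at the copy leaves the list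
    \<open>{f i, g i}\<close> for the cycle vertex.\<close>
  define g where "g i = 6 - f i - q (i mod n)" for i
  have modn: "i mod n < n" for i using n by simp
  have fq: "f i \<in> {1..3}" "q (i mod n) \<in> {1..3}" "q (i mod n) \<noteq> f i" for i
    using pc modn[of i] x(1)[of "i mod n"] unfolding proper_coloring_corona_path f_def q_def by auto
  have g: "g i \<in> {1..3}" "g i \<noteq> f i" "g i \<noteq> q (i mod n)" for i
    using third_color(1-3)[OF fq(1,2)] fq(3) unfolding g_def by metis+
  have "f i \<noteq> f (Suc i)" for i
  proof -
    have "(i mod n, Suc i mod n) \<in> parcs (cycle_graph n)"
      using modn[of i] modn[of "Suc i"] by (simp add: cycle_graph_def mod_Suc_eq)
    then show ?thesis using pc unfolding proper_coloring_corona_path f_def by auto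
  qed
  then obtain h where h: "\<And>i. h (i + n) = h i" "\<And>i. h i \<in> {f i, g i}"
      "\<And>i. h i \<noteq> h (Suc i)" and hf: "h \<noteq> f"
    using cycle_second_choice[OF n, of f g] g(2) by (auto simp: f_def g_def)
  have hq: "h i \<in> {1..3}" "q i \<in> {1..3}" "q i \<noteq> h i" if "i < n" for i
    using h(2)[of i] fq[of i] g[of i] that by auto
  have "h (n - 1) \<noteq> h 0" using h(3)[of "n - 1"] h(1)[of 0] n by simp
  \<comment> \<open>With \<open>x\<close> as reference positions, the prescribed vertices keep their
    colors \<open>q\<close> while the cycle is recolored by \<open>h\<close>.\<close>
  define d where "d = corona_path_coloring (cycle_graph n) m h q x"
  have "proper_coloring ?K 3 d"
    unfolding d_def
  proof (rule proper_corona_path_coloring)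
    show "u \<in> pverts (cycle_graph n) \<and> v \<in> pverts (cycle_graph n) \<and> h u \<noteq> h v"
      if "(u, v) \<in> parcs (cycle_graph n)" for u v
      using cycle_graph_arcs_neqI[OF n that, of h] h(3) \<open>h (n - 1) \<noteq> h 0\<close> by blast
  qed (use hq in auto)
  moreover have "d w = c w" if "w \<in> S" for w
    using that x(1) by (auto simp: S_eq d_def q_def)
  ultimately have "extension ?K S c0 d" using cS by (simp add: extension_def chi)
  then have "d = c" by (rule uniq)
  \<comment> \<open>Periodicity carries the agreement on the \<open>n\<close> cycle vertices over to
    all indices, as needed to contradict \<open>hf\<close>.\<close>
  have "h i = f i" for i
  proof -
    have "d (Inl (i mod n)) = h i"
      using modn[of i] periodic_mod[of h n i, OF h(1)] by (simp add: d_def)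
    then show ?thesis by (simp add: \<open>d = c\<close> f_def)
  qed
  then show False using hf by auto
qed

theorem theorem2p6:
  fixes n m :: nat
  assumes "n \<ge> 3" and "m \<ge> 2"
  shows "sudoku_number (with_proj (corona (cycle_graph n) (path_graph m))) = n + 1"
proof (rule antisym)
  let ?K = "with_proj (corona (cycle_graph n) (path_graph m))"
  interpret K: pair_graph "corona (cycle_graph n) (path_graph m)"
    by (intro pair_graph_corona pair_graph_cycle_graph pair_graph_path_graph assms)
  let ?S = "insert (Inl 0) ((\<lambda>i. Inr (i, 0)) ` {..<n}) :: (nat + nat \<times> nat) set"
  have "card ((\<lambda>i. Inr (i, 0) :: nat + nat \<times> nat) ` {..<n}) = n"
    by (subst card_image) (auto intro: inj_onI)
  then have "card ?S = n + 1" by (subst card_insert_disjoint) auto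
  moreover have "?S \<subseteq> verts ?K"
    using assms by (auto simp: corona_def path_graph_def)
  ultimately show "sudoku_number ?K \<le> n + 1"
    unfolding sudoku_number_def
    using sudoku_coloring_corona_cycle_path[OF assms] by (intro Least_le) blast
  obtain S c0 where S: "S \<subseteq> verts ?K" "card S = sudoku_number ?K" "sudoku_coloring ?K S c0"
    using K.sudoku_number_attained by auto
  from S(1) have "finite S" using K.pair_finite_verts by (auto intro: finite_subset)
  then show "n + 1 \<le> sudoku_number ?K"
    using sudoku_coloring_card_gt[OF assms S(3)] S(2) by simp
qed

end
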